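(* Let $L$ be a left pre-Lie algebra over a field $F$, and let $B$, $C$ be ideals of $L$ such that $L = B + C$. Let $k$ be a positive integer and suppose that $B^k = \langle 0\rangle$ and $C^3 = \langle 0\rangle$. If $B$ is abelian, then $L^4 = \langle 0\rangle$. If $k > 2$, then $L^{2k} = \langle 0\rangle$.
   Context: A left pre-Lie algebra over a field $F$ is an $F$-vector space $L$ with a bilinear product $\cdot$ satisfying $(x\cdot y)\cdot z - x\cdot(y\cdot z) = (y\cdot x)\cdot z - y\cdot(x\cdot z)$ for all $x,y,z\in L$. An ideal of $L$ is a two-sided ideal (a subspace $I$ with $x\cdot a, a\cdot x\in I$ for all $x \in L$, $a\in I$). For subspaces $U,V$ of $L$, $U\cdot V$ denotes the subspace spanned by all products $u\cdot v$ with $u\in U$, $v\in V$. For a pre-Lie algebra $A$ (in particular for an ideal of $L$, regarded as an algebra in its own right) put $A^1 = A$ and $A^{n+1} = A\cdot A^n$ for all positive integers $n$. $A$ is abelian if $x\cdot y = 0$ for all $x,y\in A$. $\langle 0\rangle$ denotes the zero subspace. *)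

theory Defs
  imports Complex_Main
begin

text \<open>The algebra is the whole type \<open>'a\<close>; subalgebras and ideals are sets of elements.\<close>

locale left_pre_lie_algebra = vector_space scale
  for scale :: "'f::field \<Rightarrow> 'a::ab_group_add \<Rightarrow> 'a" +
  fixes mult :: "'a \<Rightarrow> 'a \<Rightarrow> 'a" (infixl "\<cdot>" 70)
  assumes linear_mult_left: "Vector_Spaces.linear scale scale (\<lambda>x. x \<cdot> y)"
    and linear_mult_right: "Vector_Spaces.linear scale scale (\<lambda>y. x \<cdot> y)"
    and left_pre_lie: "(x \<cdot> y) \<cdot> z - x \<cdot> (y \<cdot> z) = (y \<cdot> x) \<cdot> z - y \<cdot> (x \<cdot> z)"
begin

definition ideal :: "'a set \<Rightarrow> bool" where
  "ideal I \<longleftrightarrow> subspace I \<and> (\<forall>x. \<forall>a\<in>I. x \<cdot> a \<in> I \<and> a \<cdot> x \<in> I)"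

definition subspace_prod :: "'a set \<Rightarrow> 'a set \<Rightarrow> 'a set" where
  "subspace_prod U V = span {u \<cdot> v | u v. u \<in> U \<and> v \<in> V}"

definition abelian :: "'a set \<Rightarrow> bool" where
  "abelian A \<longleftrightarrow> (\<forall>x\<in>A. \<forall>y\<in>A. x \<cdot> y = 0)"

text \<open>Powers start at exponent 1; the value at exponent 0 is a dummy.\<close>

fun left_power :: "'a set \<Rightarrow> nat \<Rightarrow> 'a set" where
  "left_power A 0 = A"
| "left_power A (Suc 0) = A"
| "left_power A (Suc (Suc n)) = subspace_prod A (left_power A (Suc n))"

end

end

theory Submission
  imports Defs
begin

text \<open>
  Left multiplications satisfy \<open>x(uv) = u(xv) + (xu - ux)v\<close>, so by induction every left power of an
  ideal is stable under left multiplication by the whole algebra. Hence in a right-normed word with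
  \<open>p\<close> letters in \<open>B\<close> and \<open>q\<close> letters in \<open>C\<close>, each letter from \<open>B\<close> raises the exponent of the power
  of \<open>B\<close> containing the word, the other letters preserve it, and symmetrically for \<open>C\<close>: the word
  lies in \<open>B\<^sup>p \<inter> C\<^sup>q\<close>. If \<open>B\<^sup>k = C\<^sup>m = 0\<close>, every word of length \<open>k + m - 1\<close> vanishes. For \<open>m = 3\<close> this
  gives exponent \<open>k + 2\<close>, which is at most \<open>2k\<close> when \<open>k \<ge> 2\<close>.
\<close>

context left_pre_lie_algebra
begin

lemma mult_add_left: "(x + y) \<cdot> z = x \<cdot> z + y \<cdot> z"
  and mult_diff_left: "(x - y) \<cdot> z = x \<cdot> z - y \<cdot> z"
  and mult_add_right: "x \<cdot> (y + z) = x \<cdot> y + x \<cdot> z"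
  and mult_scale_right: "x \<cdot> scale r y = scale r (x \<cdot> y)"
  and mult_zero_right: "x \<cdot> 0 = 0"
proof -
  interpret l: Vector_Spaces.linear scale scale "\<lambda>x. x \<cdot> z" by (rule linear_mult_left)
  interpret r: Vector_Spaces.linear scale scale "\<lambda>y. x \<cdot> y" by (rule linear_mult_right)
  show "(x + y) \<cdot> z = x \<cdot> z + y \<cdot> z" by (rule l.add)
  show "(x - y) \<cdot> z = x \<cdot> z - y \<cdot> z" by (rule l.diff)
  show "x \<cdot> (y + z) = x \<cdot> y + x \<cdot> z" by (rule r.add)
  show "x \<cdot> scale r y = scale r (x \<cdot> y)" by (rule r.scale)
  show "x \<cdot> 0 = 0" by (rule r.zero)
qed

text \<open>The pre-Lie identity, solved so that for \<open>u\<close> in an ideal both summands have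
  their left factor in that ideal.\<close>

lemma mult_left_swap: "x \<cdot> (u \<cdot> v) = u \<cdot> (x \<cdot> v) + (x \<cdot> u - u \<cdot> x) \<cdot> v"
  using left_pre_lie[of x u v] by (simp add: mult_diff_left algebra_simps)

text \<open>Lets \<open>span_minimal\<close> reduce a claim about \<open>x \<cdot> w\<close>, for
  \<open>w\<close> in a span, to generators.\<close>

lemma subspace_mult_vimage: "subspace S \<Longrightarrow> subspace {w. x \<cdot> w \<in> S}"
  by (simp add: subspace_def mult_add_right mult_scale_right mult_zero_right)

lemma subspace_left_power: "ideal A \<Longrightarrow> subspace (left_power A n)"
  by (cases "(A, n)" rule: left_power.cases) (simp_all add: ideal_def subspace_prod_def)

lemma mult_mem_left_power_Suc:
  "n \<ge> 1 \<Longrightarrow> a \<in> A \<Longrightarrow> w \<in> left_power A n \<Longrightarrow> a \<cdot> w \<in> left_power A (Suc n)"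
  by (cases n) (auto simp: subspace_prod_def intro!: span_base)

lemma left_power_left_ideal:
  assumes "ideal A" "w \<in> left_power A n"
  shows "x \<cdot> w \<in> left_power A n"
  using assms(2)
proof (induction n arbitrary: x w)
  case 0
  then show ?case using assms(1) by (simp add: ideal_def)
next
  case (Suc n)
  show ?case
  proof (cases n)
    case 0
    then show ?thesis using Suc.prems assms(1) by (simp add: ideal_def)
  next
    case (Suc m)
    let ?S = "left_power A (Suc n)"
    have "u \<cdot> v \<in> {w. x \<cdot> w \<in> ?S}" if "u \<in> A" "v \<in> left_power A n" for u v
    proof -
      \<comment> \<open>Two-sidedness of \<open>A\<close> enters here: both products in the
        commutator must lie in \<open>A\<close>.\<close>
      have "x \<cdot> u - u \<cdot> x \<in> A"
        using assms(1) \<open>u \<in> A\<close> by (simp add: ideal_def subspace_diff)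
      then have "(x \<cdot> u - u \<cdot> x) \<cdot> v \<in> ?S" "u \<cdot> (x \<cdot> v) \<in> ?S"
        using that Suc.IH[OF that(2)] mult_mem_left_power_Suc[of n] Suc by auto
      then show ?thesis
        using subspace_add[OF subspace_left_power[OF assms(1)]] by (simp add: mult_left_swap[of x u v])
    qed
    then have "span {u \<cdot> v | u v. u \<in> A \<and> v \<in> left_power A n} \<subseteq> {w. x \<cdot> w \<in> ?S}"
      by (intro span_minimal subspace_mult_vimage subspace_left_power assms(1)) auto
    then show ?thesis using Suc.prems Suc by (auto simp: subspace_prod_def)
  qed
qed

lemma left_power_antimono:
  assumes "ideal A" "1 \<le> m" "m \<le> n"
  shows "left_power A n \<subseteq> left_power A m"
  using assms(3)
proof (induction n rule: dec_induct)
  case (step n)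
  then obtain j where n: "n = Suc j" using assms(2) by (cases n) auto
  have "left_power A (Suc n) \<subseteq> left_power A n"
    unfolding n left_power.simps(3) subspace_prod_def
    using left_power_left_ideal[OF assms(1)]
    by (intro span_minimal subspace_left_power assms(1)) auto
  then show ?case using step.IH by blast
qed simp

text \<open>Unlike \<^const>\<open>left_power\<close>, the filtration takes the whole algebra at index 0, so that
  membership in its \<open>n\<close>-th term also makes sense for words without letters from \<open>A\<close>.\<close>

definition left_filtration :: "'a set \<Rightarrow> nat \<Rightarrow> 'a set" where
  "left_filtration A n = (if n = 0 then UNIV else left_power A n)"

lemma left_filtration_left_ideal:
  "ideal A \<Longrightarrow> w \<in> left_filtration A n \<Longrightarrow> x \<cdot> w \<in> left_filtration A n"
  by (auto simp: left_filtration_def left_power_left_ideal)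

lemma mult_mem_left_filtration_Suc:
  assumes "ideal A" "a \<in> A" "w \<in> left_filtration A n"
  shows "a \<cdot> w \<in> left_filtration A (Suc n)"
proof (cases n)
  case 0
  \<comment> \<open>Here \<open>w\<close> is arbitrary; \<open>a \<cdot> w\<close> lies in
    \<open>A\<close> because the ideal absorbs factors on the right.\<close>
  then show ?thesis using assms by (simp add: left_filtration_def ideal_def)
next
  case (Suc m)
  then show ?thesis
    using assms mult_mem_left_power_Suc[of n a A w] by (simp add: left_filtration_def)
qed

lemma left_filtration_eq_zero:
  assumes "ideal A" "k \<ge> 1" "left_power A k = {0}" "k \<le> n"
  shows "left_filtration A n \<subseteq> {0}"
  using left_power_antimono[OF assms(1,2,4)] assms by (simp add: left_filtration_def)

text \<open>Splitting every letter as \<open>b + c\<close> expands a product into words;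
  \<open>p\<close> counts the letters from \<open>B\<close>, and the others come from
  \<open>C\<close>.\<close>

lemma left_power_UNIV_subset_span:
  assumes B: "ideal B" and C: "ideal C" and BC: "UNIV = {b + c | b c. b \<in> B \<and> c \<in> C}"
  shows "left_power UNIV (Suc n) \<subseteq>
    span (\<Union>p\<le>Suc n. left_filtration B p \<inter> left_filtration C (Suc n - p))"
proof -
  have decomp: "\<exists>b\<in>B. \<exists>c\<in>C. x = b + c" for x
  proof -
    have "x \<in> {b + c | b c. b \<in> B \<and> c \<in> C}" unfolding BC[symmetric] by (rule UNIV_I)
    then show ?thesis by auto
  qed
  show ?thesis
  proof (induction n)
    case 0
    have "b + c \<in> span (\<Union>p\<le>Suc 0. left_filtration B p \<inter> left_filtration C (Suc 0 - p))"
      if "b \<in> B" "c \<in> C" for b c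
      \<comment> \<open>\<open>b\<close> belongs to the term \<open>p = 1\<close> and
        \<open>c\<close> to the term \<open>p = 0\<close>.\<close>
      using that by (intro span_add span_base) (auto simp: left_filtration_def atMost_Suc)
    then have "x \<in> span (\<Union>p\<le>Suc 0. left_filtration B p \<inter> left_filtration C (Suc 0 - p))" for x
      using decomp[of x] by (elim bexE) simp
    then show ?case by (rule subsetI)
  next
    case (Suc n)
    let ?W = "\<lambda>n. \<Union>p\<le>n. left_filtration B p \<inter> left_filtration C (n - p)"
    have "x \<cdot> w \<in> span (?W (Suc (Suc n)))" if w: "w \<in> ?W (Suc n)" for x w
    proof -
      obtain b c where x: "x = b + c" "b \<in> B" "c \<in> C" using decomp[of x] by (elim bexE)
      obtain p where p: "p \<le> Suc n" "w \<in> left_filtration B p" "w \<in> left_filtration C (Suc n - p)"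
        using w by blast
      \<comment> \<open>A letter from \<open>B\<close> raises \<open>p\<close> and leaves the index
        for \<open>C\<close> unchanged; below, a letter from \<open>C\<close> does the
        opposite.\<close>
      have "b \<cdot> w \<in> left_filtration B (Suc p) \<inter> left_filtration C (Suc (Suc n) - Suc p)"
        using p x B C by (simp add: mult_mem_left_filtration_Suc left_filtration_left_ideal)
      then have "b \<cdot> w \<in> ?W (Suc (Suc n))"
        using p(1) by (intro UN_I[of "Suc p"]) auto
      moreover have "c \<cdot> w \<in> left_filtration B p \<inter> left_filtration C (Suc (Suc n) - p)"
        using p x B C
        by (simp add: mult_mem_left_filtration_Suc left_filtration_left_ideal Suc_diff_le)
      then have "c \<cdot> w \<in> ?W (Suc (Suc n))"
        using p(1) by (intro UN_I[of p]) auto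
      ultimately have "b \<cdot> w + c \<cdot> w \<in> span (?W (Suc (Suc n)))"
        by (intro span_add span_base)
      then show ?thesis unfolding x(1) mult_add_left .
    qed
    then have "span (?W (Suc n)) \<subseteq> {w. x \<cdot> w \<in> span (?W (Suc (Suc n)))}" for x
      by (intro span_minimal subspace_mult_vimage) auto
    then show ?case
      using Suc.IH unfolding left_power.simps(3) subspace_prod_def
      by (intro span_minimal) auto
  qed
qed

theorem left_power_UNIV_eq_zero:
  assumes B: "ideal B" "k \<ge> 1" "left_power B k = {0}"
    and C: "ideal C" "m \<ge> 1" "left_power C m = {0}"
    and BC: "UNIV = {b + c | b c. b \<in> B \<and> c \<in> C}"
    and n: "n \<ge> k + m - 1"
  shows "left_power UNIV n = {0}"
proof -
  obtain j where j: "n = Suc j" using B(2) C(2) n by (cases n) auto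
  \<comment> \<open>Pigeonhole: since \<open>n \<ge> k + m - 1\<close>, either
    \<open>p \<ge> k\<close> or \<open>n - p \<ge> m\<close>.\<close>
  have "left_filtration B p \<inter> left_filtration C (n - p) \<subseteq> {0}" for p
  proof (cases "k \<le> p")
    case True
    then show ?thesis using left_filtration_eq_zero[OF B] by blast
  next
    case False
    then have "m \<le> n - p" using n by linarith
    then show ?thesis using left_filtration_eq_zero[OF C] by blast
  qed
  then have "span (\<Union>p\<le>n. left_filtration B p \<inter> left_filtration C (n - p)) \<subseteq> {0}"
    by (intro span_minimal) auto
  then have "left_power UNIV n \<subseteq> {0}"
    using left_power_UNIV_subset_span[OF B(1) C(1) BC, of j] unfolding j by blast
  \<comment> \<open>Gives the reverse inclusion: left powers of an ideal are subspaces and so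
    contain 0.\<close>
  moreover have "ideal UNIV" by (simp add: ideal_def)
  ultimately show ?thesis using subspace_0[OF subspace_left_power] by blast
qed

lemma abelian_left_power_2: "ideal A \<Longrightarrow> abelian A \<Longrightarrow> left_power A 2 = {0}"
proof -
  assume A: "ideal A" "abelian A"
  then have "left_power A 2 \<subseteq> {0}"
    unfolding numeral_2_eq_2 left_power.simps subspace_prod_def
    by (intro span_minimal) (auto simp: abelian_def)
  then show ?thesis using subspace_0[OF subspace_left_power[OF A(1)]] by blast
qed

end

theorem theoremA:
  fixes scale :: "'f::field \<Rightarrow> 'a::ab_group_add \<Rightarrow> 'a"
    and mult :: "'a \<Rightarrow> 'a \<Rightarrow> 'a"
    and B C :: "'a set"
    and k :: nat
  assumes "left_pre_lie_algebra scale mult"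
    and "left_pre_lie_algebra.ideal scale mult B"
    and "left_pre_lie_algebra.ideal scale mult C"
    and "(UNIV :: 'a set) = {b + c | b c. b \<in> B \<and> c \<in> C}"
    and "k \<ge> 1"
    and "left_pre_lie_algebra.left_power scale mult B k = {0}"
    and "left_pre_lie_algebra.left_power scale mult C 3 = {0}"
  shows "(left_pre_lie_algebra.abelian mult B \<longrightarrow>
            left_pre_lie_algebra.left_power scale mult UNIV 4 = {0}) \<and>
         (k > 2 \<longrightarrow>
            left_pre_lie_algebra.left_power scale mult UNIV (2 * k) = {0})"
proof -
  interpret left_pre_lie_algebra scale mult by fact
  note zero = left_power_UNIV_eq_zero[OF assms(2) _ _ assms(3) _ assms(7) assms(4)]
  have "left_power UNIV 4 = {0}" if "abelian B"
    \<comment> \<open>The exponent 2 replaces \<open>k\<close> for abelian \<open>B\<close>, and 2 +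
      3 - 1 = 4.\<close>
    using zero[of 2] abelian_left_power_2[OF assms(2) that] by simp
  moreover have "left_power UNIV (2 * k) = {0}" if "k > 2"
    using zero[OF assms(5,6)] that by simp
  ultimately show ?thesis by blast
qed

end
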